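(* For every integer $n\ge 2$, \[ R_<(\mathrm{AP}_n)\le 2n-2+\left\lfloor\frac{\sqrt{2(n-2)^2+(-1)^n}-1}{2}\right\rfloor . \] In particular $R_<(\mathrm{AP}_n)\le \left(2+\frac{\sqrt2}{2}+o(1)\right)n$ as $n\to\infty$.
   Context: An ordered graph is a graph whose vertex set is equipped with a total order; an $n$-vertex ordered graph is identified with a graph on vertex set $[n]=\{1,\dots,n\}$ ordered as the integers. An ordered graph $G$ contains an ordered graph $H$ if there is an injection $f:V(H)\to V(G)$ such that $f(i)<f(j)$ whenever $i<j$, and $f(i)f(j)\in E(G)$ whenever $ij\in E(H)$. $K_N^<$ denotes the complete graph on $[N]$ with the natural order. The ordered Ramsey number $R_<(H)$ is the smallest integer $N$ such that every red/blue colouring of the edges of $K_N^<$ contains a monochromatic copy of $H$ (i.e. the ordered graph formed by the edges of one colour contains $H$). The alternating path $\mathrm{AP}_n$ is the ordered path on vertex set $[n]$ whose vertices, in the order they are traversed along the path, are $1, n, 2, n-1, 3, n-2, \dots$; that is, the $(2j-1)$-th vertex of the path is $j$ and the $(2j)$-th vertex is $n+1-j$ (for all indices $\le n$). *)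

theory Defs
  imports Complex_Main "HOL-Library.Ramsey" "HOL-Library.Landau_Symbols"
begin

text \<open>An ordered graph is a simple graph whose vertices carry the order of a linearly ordered
  type; edges are two-element sets of vertices.\<close>

record 'a ograph =
  verts :: "'a set"
  edges :: "'a set set"

definition is_ograph :: "'a::linorder ograph \<Rightarrow> bool" where
  "is_ograph G \<longleftrightarrow> finite (verts G) \<and> edges G \<subseteq> nsets (verts G) 2"

definition contains :: "'a::linorder ograph \<Rightarrow> 'b::linorder ograph \<Rightarrow> bool" where
  "contains G H \<longleftrightarrow>
     (\<exists>f. inj_on f (verts H) \<and> f ` verts H \<subseteq> verts G \<and>
          (\<forall>i\<in>verts H. \<forall>j\<in>verts H. i < j \<longrightarrow> f i < f j) \<and>
          (\<forall>i\<in>verts H. \<forall>j\<in>verts H. {i, j} \<in> edges H \<longrightarrow> {f i, f j} \<in> edges G))"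

definition complete_ograph :: "nat \<Rightarrow> nat ograph" where
  "complete_ograph N = \<lparr>verts = {1..N}, edges = nsets {1..N} 2\<rparr>"

datatype colour = Red | Blue

text \<open>Only the values of \<open>c\<close> on edges of \<open>G\<close> are relevant.\<close>

definition colour_class :: "'a::linorder ograph \<Rightarrow> ('a set \<Rightarrow> colour) \<Rightarrow> colour \<Rightarrow> 'a ograph" where
  "colour_class G c k = \<lparr>verts = verts G, edges = {e \<in> edges G. c e = k}\<rparr>"

definition ordered_ramsey :: "'a::linorder ograph \<Rightarrow> nat" where
  "ordered_ramsey H =
     (LEAST N. \<forall>c. \<exists>k. contains (colour_class (complete_ograph N) c k) H)"

text \<open>\<open>ap_vertex n k\<close> is the \<open>k\<close>-th vertex along the path, for \<open>1 \<le> k \<le> n\<close>.\<close>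

definition ap_vertex :: "nat \<Rightarrow> nat \<Rightarrow> nat" where
  "ap_vertex n k = (if odd k then (k + 1) div 2 else n + 1 - k div 2)"

definition alt_path :: "nat \<Rightarrow> nat ograph" where
  "alt_path n = \<lparr>verts = {1..n},
                 edges = {{ap_vertex n k, ap_vertex n (k + 1)} | k. 1 \<le> k \<and> k < n}\<rparr>"

lemma is_ograph_complete_ograph: "is_ograph (complete_ograph N)"
  by (simp add: is_ograph_def complete_ograph_def)

lemma ap_vertex_bij: "bij_betw (ap_vertex n) {1..n} {1..n}"
proof -
  have "inj_on (ap_vertex n) {1..n}"
    unfolding inj_on_def ap_vertex_def by (auto elim!: oddE evenE split: if_splits)
  moreover have "ap_vertex n ` {1..n} \<subseteq> {1..n}"
    unfolding ap_vertex_def by (auto elim!: oddE evenE)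
  ultimately show ?thesis
    by (simp add: bij_betw_def endo_inj_surj)
qed

lemma is_ograph_alt_path: "is_ograph (alt_path n)"
proof -
  have "{ap_vertex n k, ap_vertex n (k + 1)} \<in> nsets {1..n} 2" if "1 \<le> k" "k < n" for k
  proof -
    have "ap_vertex n k \<in> {1..n}" "ap_vertex n (k + 1) \<in> {1..n}"
      using ap_vertex_bij[of n] that by (auto dest!: bij_betw_imp_surj_on)
    moreover have "ap_vertex n k \<noteq> ap_vertex n (k + 1)"
      using bij_betw_imp_inj_on[OF ap_vertex_bij[of n]] that by (auto dest: inj_onD)
    ultimately show ?thesis by (simp add: nsets_def)
  qed
  then show ?thesis by (auto simp: is_ograph_def alt_path_def)
qed

end

theory Submission
  imports Defs
begin

text \<open>Regard an edge \<open>{x, y}\<close> with \<open>x < y\<close> as the cell \<open>(x, y)\<close>.  With \<open>m = n - 2\<close>, a copy of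
  the alternating path is a staircase of cells with \<open>m\<close> moves that alternately increase \<open>x\<close> and
  decrease \<open>y\<close>, and it makes \<open>r = \<lceil>m/2\<rceil>\<close> moves of the first and \<open>s = \<lfloor>m/2\<rfloor>\<close> of the second kind.
  Deleting in turn the leftmost cell of every row and the topmost cell of every column shows that a
  staircase-free set of cells in a box with \<open>a\<close> columns and \<open>b\<close> rows has at most
  \<open>r b + s a - r s\<close> elements.

  Let \<open>P\<close> consist of the cells with \<open>x \<le> N - 2 s\<close> and \<open>y > 2 r\<close>.  Two triangles of cells in the
  bottom left and the top right corner of \<open>P\<close> are met by no staircase inside \<open>P\<close>, because too few
  moves are available there.  Hence these triangles may be added to both colour classes of \<open>P\<close>;
  the two enlarged classes together have \<open>|P|\<close> plus the size of the triangles many cells, which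
  exceeds \<open>2 (r b + s a - r s)\<close> as soon as \<open>(N - 2 m choose 2) > r s\<close>.\<close>

section \<open>Staircases in sets of cells\<close>

text \<open>The last cells of the staircases with \<open>t\<close> moves inside \<open>S\<close>.
  Recursion on the last move makes the cells lost from one stage to the next easy to count.\<close>

primrec stair_ends :: "(nat \<times> nat) set \<Rightarrow> nat \<Rightarrow> (nat \<times> nat) set" where
  "stair_ends S 0 = S"
| "stair_ends S (Suc t) =
     (if even t then {(x, y) \<in> S. \<exists>x'<x. (x', y) \<in> stair_ends S t}
      else {(x, y) \<in> S. \<exists>y'>y. (x, y') \<in> stair_ends S t})"

definition staircase :: "(nat \<times> nat) set \<Rightarrow> nat \<Rightarrow> (nat \<Rightarrow> nat \<times> nat) \<Rightarrow> bool" where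
  "staircase S m p \<longleftrightarrow> (\<forall>t\<le>m. p t \<in> S) \<and>
     (\<forall>t<m. if even t then snd (p (Suc t)) = snd (p t) \<and> fst (p t) < fst (p (Suc t))
            else fst (p (Suc t)) = fst (p t) \<and> snd (p (Suc t)) < snd (p t))"

lemma stair_ends_subset: "stair_ends S t \<subseteq> S"
  by (cases t) auto

lemma stair_ends_imp_staircase:
  "e \<in> stair_ends S m \<Longrightarrow> \<exists>p. staircase S m p \<and> p m = e"
proof (induction m arbitrary: e)
  case 0
  then show ?case by (intro exI[of _ "\<lambda>_. e"]) (auto simp: staircase_def)
next
  case (Suc m)
  obtain e' where e': "e' \<in> stair_ends S m" and
    move: "if even m then snd e = snd e' \<and> fst e' < fst e else fst e = fst e' \<and> snd e < snd e'"
    using Suc.prems by (cases e) (auto split: if_splits)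
  from Suc.IH[OF e'] obtain p where p: "staircase S m p" "p m = e'" by blast
  have "e \<in> S" using Suc.prems stair_ends_subset by blast
  with p move have "staircase S (Suc m) (p(Suc m := e))"
    unfolding staircase_def by (auto simp: less_Suc_eq le_Suc_eq)
  then show ?case by (metis fun_upd_same)
qed

text \<open>The first \<open>t\<close> moves comprise \<open>(t + 1) div 2\<close> increases of
  \<open>x\<close> and \<open>t div 2\<close> decreases of \<open>y\<close>, each by at least
  1.\<close>

lemma stair_ends_bounds:
  assumes "S \<subseteq> {1..a} \<times> {l + 1..l + b}" and "(x, y) \<in> stair_ends S t"
  shows "(t + 1) div 2 < x \<and> y + t div 2 \<le> l + b"
  using assms(2)
proof (induction t arbitrary: x y)
  case 0
  then show ?case using assms(1) by auto
next
  case (Suc t)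
  show ?case
  proof (cases "even t")
    case True
    then obtain x' where "x' < x" "(x', y) \<in> stair_ends S t" using Suc.prems by auto
    with Suc.IH[of x' y] True show ?thesis by (auto elim!: evenE)
  next
    case False
    then obtain y' where "y < y'" "(x, y') \<in> stair_ends S t" using Suc.prems by auto
    with Suc.IH[of x y'] False show ?thesis by (auto elim!: oddE)
  qed
qed

text \<open>A cell that drops out is the leftmost of its row in \<open>stair_ends S t\<close>
  (\<open>t\<close> even) or the topmost of its column (\<open>t\<close> odd), so each line loses at
  most one. \<open>stair_ends_bounds\<close> limits the lines that still occur.\<close>

lemma card_stair_ends_step:
  assumes S: "S \<subseteq> {1..a} \<times> {l + 1..l + b}"
  shows "card (stair_ends S t) \<le> card (stair_ends S (Suc t)) +
           (if even t then b - t div 2 else a - (t + 1) div 2)"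
proof -
  let ?Z = "stair_ends S t" and ?Z' = "stair_ends S (Suc t)"
  have fin: "finite S" using S by (rule finite_subset) simp
  then have finZ: "finite ?Z" "finite ?Z'" using stair_ends_subset finite_subset by blast+
  have "card (?Z - ?Z') \<le> (if even t then b - t div 2 else a - (t + 1) div 2)"
  proof (cases "even t")
    case True
    have "inj_on snd (?Z - ?Z')"
    proof (rule inj_onI)
      fix e e' assume e: "e \<in> ?Z - ?Z'" "e' \<in> ?Z - ?Z'" and eq: "snd e = snd e'"
      then have "e \<in> S" "e' \<in> S" using stair_ends_subset by blast+
      with e eq True have "\<not> fst e < fst e'" "\<not> fst e' < fst e"
        by (auto simp: prod_eq_iff)
      with eq show "e = e'" by (simp add: prod_eq_iff)
    qed
    moreover have "snd ` (?Z - ?Z') \<subseteq> {l + 1..l + b - t div 2}"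
      using S stair_ends_subset[of S t] stair_ends_bounds[OF S, of _ _ t] by fastforce
    ultimately have "card (?Z - ?Z') \<le> card {l + 1..l + b - t div 2}"
      by (metis card_image card_mono finite_atLeastAtMost)
    then show ?thesis using True by simp
  next
    case False
    have "inj_on fst (?Z - ?Z')"
    proof (rule inj_onI)
      fix e e' assume e: "e \<in> ?Z - ?Z'" "e' \<in> ?Z - ?Z'" and eq: "fst e = fst e'"
      then have "e \<in> S" "e' \<in> S" using stair_ends_subset by blast+
      with e eq False have "\<not> snd e < snd e'" "\<not> snd e' < snd e"
        by (auto simp: prod_eq_iff)
      with eq show "e = e'" by (simp add: prod_eq_iff)
    qed
    moreover have "fst ` (?Z - ?Z') \<subseteq> {(t + 1) div 2 + 1..a}"
      using S stair_ends_subset[of S t] stair_ends_bounds[OF S, of _ _ t] by fastforce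
    ultimately have "card (?Z - ?Z') \<le> card {(t + 1) div 2 + 1..a}"
      by (metis card_image card_mono finite_atLeastAtMost)
    then show ?thesis using False by simp
  qed
  moreover have "card ?Z \<le> card (?Z - ?Z') + card ?Z'"
    using diff_card_le_card_Diff[OF finZ(2), of ?Z] by linarith
  ultimately show ?thesis by linarith
qed

text \<open>Summing the step bounds gives \<open>r b + s a - r (r - 1) / 2 - s (s + 1) / 2\<close>
  for \<open>r = (m + 1) div 2\<close>, \<open>s = m div 2\<close>. As \<open>r\<close> is
  \<open>s\<close> or \<open>s + 1\<close>, the two subtracted terms add up to
  \<open>r s\<close>.\<close>

lemma card_le_stair_ends:
  assumes S: "S \<subseteq> {1..a} \<times> {l + 1..l + b}" and "m \<le> a" "m \<le> b"
  shows "int (card S) \<le> int (card (stair_ends S m)) + int ((m + 1) div 2) * int b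
           + int (m div 2) * int a - int ((m + 1) div 2) * int (m div 2)"
  using assms(2,3)
proof (induction m)
  case 0
  then show ?case by simp
next
  case (Suc m)
  have step: "int (card (stair_ends S m)) \<le> int (card (stair_ends S (Suc m))) +
      (if even m then int b - int (m div 2) else int a - int ((m + 1) div 2))"
    using card_stair_ends_step[OF S, of m] Suc.prems by (auto simp del: stair_ends.simps split: if_splits)
  show ?case
  proof (cases "even m")
    case True
    then obtain j where "m = 2 * j" by (elim evenE)
    then show ?thesis using step Suc.IH Suc.prems by (simp del: stair_ends.simps add: algebra_simps)
  next
    case False
    then obtain j where "m = 2 * j + 1" by (elim oddE)
    then show ?thesis using step Suc.IH Suc.prems by (simp del: stair_ends.simps add: algebra_simps)
  qed
qed

text \<open>Counts the moves of each kind between times \<open>i\<close> and \<open>t\<close>; sums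
  on both sides avoid truncated subtraction.\<close>

lemma staircase_mono:
  assumes "staircase S m p" and "i \<le> t" "t \<le> m"
  shows "fst (p i) + (t + 1) div 2 \<le> fst (p t) + (i + 1) div 2"
    and "snd (p t) + t div 2 \<le> snd (p i) + i div 2"
proof -
  have "fst (p i) + (t + 1) div 2 \<le> fst (p t) + (i + 1) div 2 \<and>
        snd (p t) + t div 2 \<le> snd (p i) + i div 2"
    using assms(2,3)
  proof (induction t rule: dec_induct)
    case base
    then show ?case by simp
  next
    case (step t)
    have "if even t then snd (p (Suc t)) = snd (p t) \<and> fst (p t) < fst (p (Suc t))
          else fst (p (Suc t)) = fst (p t) \<and> snd (p (Suc t)) < snd (p t)"
      using assms(1) step.prems by (simp add: staircase_def)
    then show ?case using step by (cases "even t") (auto elim!: evenE oddE)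
  qed
  then show "fst (p i) + (t + 1) div 2 \<le> fst (p t) + (i + 1) div 2"
    and "snd (p t) + t div 2 \<le> snd (p i) + i div 2" by auto
qed

section \<open>Staircases are alternating paths\<close>

text \<open>The cell \<open>p t\<close> is the edge joining path vertices \<open>t + 1\<close> and
  \<open>t + 2\<close>. Consecutive cells share a coordinate, which is the path vertex common to
  both edges.\<close>

lemma staircase_imp_contains:
  assumes p: "staircase S m p" and n: "n = m + 2"
    and S: "\<And>t. t \<le> m \<Longrightarrow> 1 \<le> fst (p t) \<and> fst (p t) < snd (p t) \<and> snd (p t) \<le> N \<and>
              c {fst (p t), snd (p t)} = k"
  shows "contains (colour_class (complete_ograph N) c k) (alt_path n)"
proof -
  \<comment> \<open>Image of the \<open>j\<close>-th path vertex, read off the first cell containing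
    it; for \<open>j = 1\<close> truncation turns \<open>j - 2\<close> into the correct index
    0.\<close>
  define v where "v j = (if odd j then fst (p (j - 2)) else snd (p (j - 2)))" for j
  \<comment> \<open>The two arguments of \<open>v\<close> invert \<open>ap_vertex n\<close>.\<close>
  define f where "f i = (if 2 * i \<le> n + 1 then v (2 * i - 1) else v (2 * (n + 1 - i)))" for i
  \<comment> \<open>Compare through the last cell, which has the largest first and the smallest
    second coordinate.\<close>
  have cross: "fst (p i) < snd (p t)" if "i \<le> m" "t \<le> m" for i t
  proof -
    have "fst (p i) \<le> fst (p m)"
      using staircase_mono(1)[OF p, of i m] div_le_mono[of "i + 1" "m + 1" 2] that by simp
    moreover have "snd (p m) \<le> snd (p t)"
      using staircase_mono(2)[OF p, of t m] div_le_mono[of t m 2] that by simp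
    ultimately show ?thesis using S[of m] by simp
  qed
  have left: "f i = fst (p (2 * i - 3))" if "2 * i \<le> n + 1" "1 \<le> i" for i
  proof -
    have "odd (2 * i - 1)" "2 * i - 1 - 2 = 2 * i - 3" using that by simp_all
    then show ?thesis using that by (simp add: f_def v_def)
  qed
  have right: "f i = snd (p (2 * (n - i)))" if "\<not> 2 * i \<le> n + 1" "i \<le> n" for i
  proof -
    have "2 * (n + 1 - i) - 2 = 2 * (n - i)" using that by simp
    then show ?thesis using that by (simp add: f_def v_def)
  qed
  have mono: "f i < f j" if "1 \<le> i" "i < j" "j \<le> n" for i j
  proof -
    consider "2 * j \<le> n + 1" | "2 * i \<le> n + 1" "\<not> 2 * j \<le> n + 1" | "\<not> 2 * i \<le> n + 1"
      using that by linarith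
    then show ?thesis
    proof cases
      case 1
      have "fst (p (2 * i - 3)) + (2 * j - 3 + 1) div 2 \<le> fst (p (2 * j - 3)) + (2 * i - 3 + 1) div 2"
        using staircase_mono(1)[OF p, of "2 * i - 3" "2 * j - 3"] 1 that n by simp
      moreover have "(2 * i - 3 + 1) div 2 < (2 * j - 3 + 1) div 2" using that by (cases i) auto
      ultimately show ?thesis using left[of i] left[of j] 1 that by simp
    next
      case 2
      then show ?thesis using left[of i] right[of j] cross[of "2 * i - 3" "2 * (n - j)"] that n by simp
    next
      case 3
      have "snd (p (2 * (n - i))) + (n - i) \<le> snd (p (2 * (n - j))) + (n - j)"
        using staircase_mono(2)[OF p, of "2 * (n - j)" "2 * (n - i)"] 3 that n by simp
      then show ?thesis using right[of i] right[of j] 3 that by simp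
    qed
  qed
  have v_path: "f (ap_vertex n j) = v j" if "1 \<le> j" "j \<le> n" for j
  proof (cases "odd j")
    case True
    then show ?thesis using that by (auto simp: f_def ap_vertex_def elim!: oddE)
  next
    case False
    then obtain i where i: "j = 2 * i" by (auto elim: evenE)
    then have "2 * (n + 1 - (n + 1 - i)) = 2 * i" "\<not> 2 * (n + 1 - i) \<le> n + 1"
      using that by simp_all
    then show ?thesis using i by (simp add: f_def ap_vertex_def)
  qed
  have edge: "{v j, v (j + 1)} = {fst (p (j - 1)), snd (p (j - 1))}" if "1 \<le> j" "j < n" for j
  proof (cases "j = 1")
    case True
    then show ?thesis by (simp add: v_def)
  next
    case False
    define t where "t = j - 2"
    with False \<open>1 \<le> j\<close> have t: "j = Suc (Suc t)" by simp
    \<comment> \<open>\<open>v j\<close> comes from \<open>p (j - 2)\<close>, but the move to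
      \<open>p (j - 1)\<close> keeps that coordinate.\<close>
    then have "if even t then snd (p (Suc t)) = snd (p t) \<and> fst (p t) < fst (p (Suc t))
          else fst (p (Suc t)) = fst (p t) \<and> snd (p (Suc t)) < snd (p t)"
      using p that n by (simp add: staircase_def)
    then show ?thesis using t by (auto simp: v_def split: if_splits)
  qed
  have v_range: "v j \<in> {1..N}" if "1 \<le> j" "j \<le> n" for j
  proof -
    have "j - 2 \<le> m" using that n by simp
    from S[OF this] show ?thesis by (auto simp: v_def)
  qed
  have f_range: "f i \<in> {1..N}" if "i \<in> {1..n}" for i
  proof -
    have "i \<in> ap_vertex n ` {1..n}"
      using bij_betw_imp_surj_on[OF ap_vertex_bij[of n]] that by simp
    then obtain j where "1 \<le> j" "j \<le> n" "i = ap_vertex n j" by auto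
    then show ?thesis using v_path v_range by simp
  qed
  have "inj_on f {1..n}"
    by (rule linorder_inj_onI) (use mono in \<open>auto dest: less_imp_neq\<close>)
  moreover have "{f i, f j} \<in> edges (colour_class (complete_ograph N) c k)"
    if "{i, j} \<in> edges (alt_path n)" for i j
  proof -
    obtain l where l: "1 \<le> l" "l < n" and ij: "{i, j} = {ap_vertex n l, ap_vertex n (l + 1)}"
      using \<open>{i, j} \<in> edges (alt_path n)\<close> by (auto simp: alt_path_def)
    have "{f i, f j} = f ` {ap_vertex n l, ap_vertex n (l + 1)}" using ij by (metis image_empty image_insert)
    also have "\<dots> = {fst (p (l - 1)), snd (p (l - 1))}"
      using l v_path[of l] v_path[of "l + 1"] edge[of l] by simp
    finally have "{f i, f j} = {fst (p (l - 1)), snd (p (l - 1))}" .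
    moreover have "l - 1 \<le> m" using l n by simp
    ultimately show ?thesis
      using S[of "l - 1"] by (auto simp: colour_class_def complete_ograph_def nsets_def card_insert_if)
  qed
  ultimately show ?thesis
    unfolding contains_def using mono f_range
    by (intro exI[of _ f]) (auto simp: alt_path_def colour_class_def complete_ograph_def)
qed

section \<open>The Ramsey bound\<close>

text \<open>The edges of the complete graph on the \<open>b\<close> consecutive vertices after
  \<open>l\<close>.\<close>

definition triangle :: "nat \<Rightarrow> nat \<Rightarrow> (nat \<times> nat) set" where
  "triangle l b = {(x, y). l < x \<and> x < y \<and> y \<le> l + b}"

lemma finite_triangle: "finite (triangle l b)"
  by (rule finite_subset[of _ "{..l + b} \<times> {..l + b}"]) (auto simp: triangle_def)

lemma card_triangle: "2 * card (triangle l b) = b * (b - 1)"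
proof (induction b)
  case 0
  have "triangle l 0 = {}" by (auto simp: triangle_def)
  then show ?case by simp
next
  case (Suc b)
  let ?T = "(\<lambda>x. (x, l + Suc b)) ` {l<..<l + Suc b}"
  have "triangle l (Suc b) = triangle l b \<union> ?T"
    by (auto simp: triangle_def image_iff)
  moreover have "triangle l b \<inter> ?T = {}" by (auto simp: triangle_def)
  ultimately have "card (triangle l (Suc b)) = card (triangle l b) + card ?T"
    by (simp add: card_Un_disjoint finite_triangle)
  moreover have "card ?T = b" by (simp add: card_image inj_on_def)
  ultimately show ?case using Suc by (cases b) auto
qed

text \<open>Here \<open>p\<close>, \<open>d1\<close>, \<open>d2\<close> stand for the sizes of
  \<open>P\<close> and the two corner triangles, \<open>u\<close> and \<open>v\<close> for those of
  the enlarged colour classes. The identity \<open>r (r - 1) + s (s + 1) = 2 r s\<close> leaves only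
  \<open>q\<close> and \<open>r s\<close>.\<close>

lemma counting_arith:
  fixes q r s a b N p d1 d2 u v :: int
  assumes "r = s \<or> r = s + 1"
    and "a = 2 * r + q" "b = 2 * s + q" "N = 2 * r + 2 * s + q"
    and "N * (N - 1) \<le> 2 * p + 2 * r * (2 * r - 1) + 2 * s * (2 * s - 1)"
    and "2 * d1 = s * (s + 1)" "2 * d2 = r * (r - 1)" and "u + v = p + d1 + d2"
    and "u \<le> r * b + s * a - r * s" "v \<le> r * b + s * a - r * s"
  shows "q * (q - 1) \<le> 2 * (r * s)"
proof -
  have "2 * p + 2 * d1 + 2 * d2 \<le> 4 * (r * b + s * a - r * s)"
    using assms(8-10) by simp
  then have "N * (N - 1) + s * (s + 1) + r * (r - 1)
      \<le> 2 * r * (2 * r - 1) + 2 * s * (2 * s - 1) + 4 * (r * b + s * a - r * s)"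
    using assms(5-7) by linarith
  with assms(2-4) have "(2 * r + 2 * s + q) * (2 * r + 2 * s + q - 1) + s * (s + 1) + r * (r - 1)
      \<le> 2 * r * (2 * r - 1) + 2 * s * (2 * s - 1) + 4 * (r * (2 * s + q) + s * (2 * r + q) - r * s)"
    by simp
  with assms(1) show ?thesis by (auto simp: algebra_simps)
qed

lemma monochromatic_alt_path:
  fixes c :: "nat set \<Rightarrow> colour"
  assumes N: "N = 2 * m + q" and q: "2 * ((m + 1) div 2 * (m div 2)) < q * (q - 1)"
  shows "\<exists>k. contains (colour_class (complete_ograph N) c k) (alt_path (m + 2))"
proof (rule ccontr)
  assume none: "\<not> ?thesis"
  define r where "r = (m + 1) div 2"
  define s where "s = m div 2"
  have m: "m = r + s" and rs: "r = s \<or> r = s + 1" unfolding r_def s_def by linarith+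
  have q2: "2 \<le> q" using q by (cases "q \<le> 1") (auto simp: le_Suc_eq)
  define a where "a = N - 2 * s"
  define b where "b = N - 2 * r"
  have a: "a + 2 * s = N" and b: "2 * r + b = N" unfolding a_def b_def using N m by auto
  define P where "P = {(x, y). 1 \<le> x \<and> x < y \<and> y \<le> N \<and> x \<le> a \<and> 2 * r < y}"
  \<comment> \<open>Sheared triangles: \<open>D1\<close> holds the cells at grid distance below
    \<open>s\<close> from the corner \<open>(1, 2 * r + 1)\<close>, \<open>D2\<close> those at
    distance below \<open>r - 1\<close> from \<open>(a, N)\<close>.\<close>
  define D1 where "D1 = (\<lambda>(x, z). (x, 2 * r + (z - x))) ` triangle 0 (s + 1)"
  define D2 where "D2 = (\<lambda>(x, z). (a + 1 - x, N + 1 - (z - x))) ` triangle 0 r"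
  have D1: "1 \<le> fst e \<and> fst e \<le> s \<and> 2 * r < snd e \<and> fst e + snd e \<le> 2 * r + s + 1"
    if "e \<in> D1" for e
    using that by (auto simp: D1_def triangle_def)
  have D2: "fst e \<le> a \<and> a < fst e + r \<and> snd e \<le> N \<and> N < snd e + r \<and> a + N + 2 \<le> fst e + snd e + r"
    if "e \<in> D2" for e
    using that a N m q2 by (auto simp: D2_def triangle_def)
  have finP: "finite P"
    by (rule finite_subset[of _ "{..N} \<times> {..N}"]) (auto simp: P_def)
  have D1P: "D1 \<subseteq> P"
  proof
    fix e assume "e \<in> D1"
    from D1[OF this] show "e \<in> P" using a N m q2 rs by (cases e) (auto simp: P_def)
  qed
  have D2P: "D2 \<subseteq> P"
  proof
    fix e assume "e \<in> D2"
    from D2[OF this] show "e \<in> P" using a N m q2 rs by (cases e) (auto simp: P_def)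
  qed
  have disj: "D1 \<inter> D2 = {}"
  proof -
    have False if "e \<in> D1" "e \<in> D2" for e
      using D1[OF that(1)] D2[OF that(2)] a N m rs by auto
    then show ?thesis by blast
  qed
  have "inj_on (\<lambda>(x, z). (x, 2 * r + (z - x))) (triangle 0 (s + 1))"
    by (auto simp: inj_on_def triangle_def)
  then have card_D1: "2 * card D1 = s * (s + 1)"
    using card_triangle[of 0 "s + 1"] by (simp add: D1_def card_image)
  have "inj_on (\<lambda>(x, z). (a + 1 - x, N + 1 - (z - x))) (triangle 0 r)"
    using a N m q2 by (auto simp: inj_on_def triangle_def)
  then have card_D2: "2 * card D2 = r * (r - 1)"
    using card_triangle[of 0 r] by (simp add: D2_def card_image)

  define K where "K k = {e \<in> P - (D1 \<union> D2). c {fst e, snd e} = k}" for k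
  define S where "S k = K k \<union> (D1 \<union> D2)" for k
  have SP: "S k \<subseteq> P" for k using D1P D2P by (auto simp: S_def K_def)
  have box: "S k \<subseteq> {1..a} \<times> {2 * r + 1..2 * r + b}" for k
    using SP[of k] b by (auto simp: P_def)
  have no_ends: "stair_ends (S k) m = {}" for k
  proof (rule ccontr)
    assume "stair_ends (S k) m \<noteq> {}"
    then obtain p where p: "staircase (S k) m p" using stair_ends_imp_staircase by blast
    have pS: "p t \<in> S k" if "t \<le> m" for t using p that by (simp add: staircase_def)
    have range: "1 \<le> fst (p t)" "fst (p t) \<le> a" "2 * r < snd (p t)" "snd (p t) \<le> N"
      if "t \<le> m" for t
      using pS[OF that] SP[of k] by (auto simp: P_def)
    \<comment> \<open>Moves made and moves left bound both coordinates of \<open>p t\<close>, so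
      \<open>x + y\<close> is at least \<open>2 r + s + 2\<close> and at most
      \<open>a + N - r + 1\<close>. The 1 in the upper bound is the possible excess of
      \<open>(t + 1) div 2\<close> over \<open>t div 2\<close>; hence \<open>D2\<close> has side
      \<open>r - 1\<close>.\<close>
    have "p t \<notin> D1 \<union> D2" if t: "t \<le> m" for t
    proof -
      have half: "t div 2 \<le> (t + 1) div 2" "(t + 1) div 2 \<le> t div 2 + 1" by simp_all
      have "1 + (t + 1) div 2 \<le> fst (p t)" "fst (p t) + r \<le> a + (t + 1) div 2"
        using staircase_mono(1)[OF p, of 0 t] staircase_mono(1)[OF p, of t m] range[of 0] range[of m] t
        by (simp_all add: r_def)
      moreover have "snd (p t) + t div 2 \<le> N" "2 * r + 1 + s \<le> snd (p t) + t div 2"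
        using staircase_mono(2)[OF p, of 0 t] staircase_mono(2)[OF p, of t m] range[of 0] range[of m] t
        by (simp_all add: s_def)
      ultimately show ?thesis using D1[of "p t"] D2[of "p t"] half by auto
    qed
    then have "1 \<le> fst (p t) \<and> fst (p t) < snd (p t) \<and> snd (p t) \<le> N \<and>
        c {fst (p t), snd (p t)} = k" if "t \<le> m" for t
      using pS[OF that] that by (auto simp: S_def K_def P_def)
    from staircase_imp_contains[OF p refl this] none show False by blast
  qed
  have "m \<le> a" "m \<le> b" using a b N m q2 rs by auto
  then have upper: "int (card (S k)) \<le> int r * int b + int s * int a - int r * int s" for k
    using card_le_stair_ends[OF box[of k], of m] no_ends[of k] by (simp add: r_def s_def)

  have finD: "finite D1" "finite D2" using finP D1P D2P finite_subset by blast+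
  have finK: "finite (K k)" for k using finP by (simp add: K_def)
  have "card (S k) = card (K k) + card (D1 \<union> D2)" for k
    unfolding S_def using finK finD by (intro card_Un_disjoint) (auto simp: K_def)
  moreover have "card (K Red) + card (K Blue) = card (P - (D1 \<union> D2))"
  proof -
    have "K Red \<union> K Blue = P - (D1 \<union> D2)"
      unfolding K_def using colour.exhaust by blast
    moreover have "K Red \<inter> K Blue = {}" by (auto simp: K_def)
    ultimately show ?thesis using card_Un_disjoint[OF finK finK, of Red Blue] by simp
  qed
  moreover have "card (P - (D1 \<union> D2)) + card (D1 \<union> D2) = card P"
  proof -
    have "D1 \<union> D2 \<subseteq> P" using D1P D2P by blast
    then show ?thesis
      using card_Diff_subset[of "D1 \<union> D2" P] card_mono[OF finP, of "D1 \<union> D2"] finD by simp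
  qed
  moreover have "card (D1 \<union> D2) = card D1 + card D2"
    using finD disj by (rule card_Un_disjoint)
  ultimately have total: "card (S Red) + card (S Blue) = card P + card D1 + card D2" by simp

  \<comment> \<open>An edge outside \<open>P\<close> has both ends among the first
    \<open>2 r\<close> or both among the last \<open>2 s\<close> vertices; this bounds
    \<open>card P\<close> from below.\<close>
  have "triangle 0 N \<subseteq> P \<union> (triangle 0 (2 * r) \<union> triangle a (2 * s))"
    using a by (auto simp: triangle_def P_def)
  then have "card (triangle 0 N) \<le> card (P \<union> (triangle 0 (2 * r) \<union> triangle a (2 * s)))"
    using finP finite_triangle by (intro card_mono) auto
  also have "\<dots> \<le> card P + (card (triangle 0 (2 * r)) + card (triangle a (2 * s)))"
    by (meson card_Un_le add_left_mono le_trans)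
  finally have "N * (N - 1) \<le> 2 * card P + (2 * r) * (2 * r - 1) + (2 * s) * (2 * s - 1)"
    using card_triangle[of 0 N] card_triangle[of 0 "2 * r"] card_triangle[of a "2 * s"] by linarith
  then have "int (N * (N - 1)) \<le> int (2 * card P + (2 * r) * (2 * r - 1) + (2 * s) * (2 * s - 1))"
    by (simp only: of_nat_le_iff)
  \<comment> \<open>Truncation is harmless at \<open>x = 0\<close>, where the factor
    \<open>x\<close> vanishes.\<close>
  moreover have pred: "int (x * (x - 1)) = int x * (int x - 1)" for x
    by (cases x) (auto simp: algebra_simps)
  ultimately have card_P: "int N * (int N - 1)
      \<le> 2 * int (card P) + 2 * int r * (2 * int r - 1) + 2 * int s * (2 * int s - 1)"
    unfolding of_nat_add pred by simp
  have "int (2 * card D1) = int (s * (s + 1))" "int (2 * card D2) = int (r * (r - 1))"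
    using card_D1 card_D2 by (simp_all only:)
  then have "2 * int (card D1) = int s * (int s + 1)" "2 * int (card D2) = int r * (int r - 1)"
    unfolding pred by (simp_all add: algebra_simps)
  moreover have "int (card (S Red)) + int (card (S Blue)) = int (card P) + int (card D1) + int (card D2)"
    using arg_cong[OF total, of int] by simp
  moreover have "int a = 2 * int r + int q" "int b = 2 * int s + int q"
    "int N = 2 * int r + 2 * int s + int q"
    using a b N m by simp_all
  moreover have "int r = int s \<or> int r = int s + 1" using rs by auto
  ultimately have "int q * (int q - 1) \<le> 2 * (int r * int s)"
    using counting_arith[OF _ _ _ _ card_P _ _ _ upper[of Red] upper[of Blue]] by simp
  moreover have "2 * (int r * int s) < int q * (int q - 1)"
  proof -
    have "int (2 * (r * s)) < int (q * (q - 1))"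
      using q unfolding r_def s_def by (simp only: of_nat_less_iff)
    then show ?thesis unfolding pred by simp
  qed
  ultimately show False by simp
qed

text \<open>Take \<open>q = M + 2\<close>. Since \<open>8 r s = 2 m^2 + (-1)^m - 1\<close> and
  \<open>4 q (q - 1) = (2 M + 3)^2 - 1\<close>, the condition \<open>2 r s < q (q - 1)\<close> says
  that the square root is below \<open>2 M + 3\<close>, which the floor ensures.\<close>

lemma ordered_ramsey_alt_path_le:
  fixes m :: nat
  shows "int (ordered_ramsey (alt_path (m + 2)))
    \<le> 2 * int m + 2 + \<lfloor>(sqrt (2 * (real m)\<^sup>2 + (-1) ^ m) - 1) / 2\<rfloor>"
proof -
  define s where "s = sqrt (2 * (real m)\<^sup>2 + (-1) ^ m)"
  have ge1: "1 \<le> 2 * (real m)\<^sup>2 + (-1) ^ m"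
  proof (cases "even m")
    case False
    then have "1 \<le> (real m)\<^sup>2" by (cases m) auto
    then show ?thesis using False by simp
  qed simp
  then have s1: "1 \<le> s" by (simp add: s_def)
  define M where "M = nat \<lfloor>(s - 1) / 2\<rfloor>"
  have M: "int M = \<lfloor>(s - 1) / 2\<rfloor>" using s1 by (simp add: M_def)
  then have "(s - 1) / 2 < real M + 1" by linarith
  then have "s < 2 * real M + 3" by simp
  then have "s\<^sup>2 < (2 * real M + 3)\<^sup>2" using s1 by (intro power_strict_mono) auto
  then have "2 * (real m)\<^sup>2 + (-1) ^ m < (2 * real M + 3)\<^sup>2"
    using ge1 by (simp add: s_def)
  then have "of_int (2 * (int m)\<^sup>2 + (-1) ^ m) < (of_int ((2 * int M + 3)\<^sup>2) :: real)"
    by simp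
  then have *: "2 * (int m)\<^sup>2 + (-1) ^ m < (2 * int M + 3)\<^sup>2"
    by (simp only: of_int_less_iff)
  have "int (2 * ((m + 1) div 2 * (m div 2))) < int ((M + 2) * (M + 2 - 1))"
  proof (cases "even m")
    case True
    then obtain j where "m = 2 * j" by (elim evenE)
    then show ?thesis using * by (simp add: power2_eq_square algebra_simps)
  next
    case False
    then obtain j where "m = 2 * j + 1" by (elim oddE)
    then show ?thesis using * by (simp add: power2_eq_square algebra_simps)
  qed
  then have "\<exists>k. contains (colour_class (complete_ograph (2 * m + (M + 2))) c k) (alt_path (m + 2))" for c
    by (intro monochromatic_alt_path[OF refl]) (simp only: of_nat_less_iff)
  then have "ordered_ramsey (alt_path (m + 2)) \<le> 2 * m + (M + 2)"
    unfolding ordered_ramsey_def by (intro Least_le) blast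
  then show ?thesis using M by (simp add: s_def)
qed

theorem theorem1p1:
  "(\<forall>n::nat. n \<ge> 2 \<longrightarrow>
      int (ordered_ramsey (alt_path n))
        \<le> 2 * int n - 2 + \<lfloor>(sqrt (2 * (real n - 2)\<^sup>2 + (-1) ^ n) - 1) / 2\<rfloor>)
   \<and> (\<exists>\<epsilon> :: nat \<Rightarrow> real. \<epsilon> \<in> o(\<lambda>_. 1) \<and>
        (\<forall>n::nat. n \<ge> 2 \<longrightarrow>
           real (ordered_ramsey (alt_path n)) \<le> (2 + sqrt 2 / 2 + \<epsilon> n) * real n))"
proof -
  have bound: "int (ordered_ramsey (alt_path n))
        \<le> 2 * int n - 2 + \<lfloor>(sqrt (2 * (real n - 2)\<^sup>2 + (-1) ^ n) - 1) / 2\<rfloor>" if "n \<ge> 2" for n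
  proof -
    define m where "m = n - 2"
    with that have "n = m + 2" by simp
    then show ?thesis using ordered_ramsey_alt_path_le[of m] by simp
  qed
  \<comment> \<open>The error term can be 0: the square root is at most
    \<open>sqrt 2 * (n - 2) + 1\<close>.\<close>
  have "real (ordered_ramsey (alt_path n)) \<le> (2 + sqrt 2 / 2 + 0) * real n" if n: "n \<ge> 2" for n
  proof -
    have pos: "0 \<le> sqrt 2 * (real n - 2)" using n by simp
    have "2 * (real n - 2)\<^sup>2 + (-1) ^ n \<le> 2 * (real n - 2)\<^sup>2 + 1"
      by (cases "even n") auto
    also have "\<dots> \<le> (sqrt 2 * (real n - 2) + 1)\<^sup>2"
      using pos by (simp add: power2_sum power_mult_distrib)
    finally have "sqrt (2 * (real n - 2)\<^sup>2 + (-1) ^ n) \<le> sqrt 2 * (real n - 2) + 1"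
      using pos by (intro real_le_lsqrt) auto
    moreover have "real_of_int (int (ordered_ramsey (alt_path n)))
        \<le> real_of_int (2 * int n - 2 + \<lfloor>(sqrt (2 * (real n - 2)\<^sup>2 + (-1) ^ n) - 1) / 2\<rfloor>)"
      using bound[OF n] by (simp only: of_int_le_iff)
    ultimately have "real (ordered_ramsey (alt_path n)) \<le> 2 * real n - 2 + sqrt 2 * (real n - 2) / 2"
      using of_int_floor_le[of "(sqrt (2 * (real n - 2)\<^sup>2 + (-1) ^ n) - 1) / 2"] by simp
    also have "\<dots> \<le> (2 + sqrt 2 / 2 + 0) * real n"
      by (simp add: algebra_simps)
    finally show ?thesis .
  qed
  then show ?thesis using bound by (intro conjI exI[of _ "\<lambda>_. 0"]) auto
qed

end
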